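(* Let $A\in\mathbb{R}^{n\times n}$ be invertible, let $X_0=\alpha A^T$ with $0<\alpha<2/\|A\|_2^2$, and let $(X_k)_{k\ge0}$, $(F_k)_{k\ge 0}$, $(\alpha_k)_{k\ge 0}$, $(\beta_k)_{k\ge 0}$ be generated by the SSHP2 method. Then SSHP2 converges if and only if $1\notin\sigma(F_k)$ for all $k\in\mathbb{N}_0$, $\lim_{k\to\infty}\alpha_k=0$ and $\lim_{k\to\infty}\beta_k=1$.
   Context: $\mathbb{N}_0=\{0,1,2,\dots\}$; $\|\cdot\|_2$ is the spectral norm, $\|\cdot\|_F$ the Frobenius norm, $\sigma(Q)$ the spectrum. SSHP2 method: for $k\in\mathbb{N}_0$ put $F_k=I-AX_k$ and $$D_k=\|I-F_k\|_F^2\,\|I-F_k^2\|_F^2-\big(\mathrm{tr}((I-F_k^2)(I-F_k))\big)^2 .$$ If $D_k\ne0$, set $$\alpha_k=\frac{\|I-F_k^2\|_F^2\,\mathrm{tr}(I-F_k)-\mathrm{tr}(I-F_k^2)\,\mathrm{tr}((I-F_k^2)(I-F_k))}{D_k},$$ $$\beta_k=\frac{\|I-F_k\|_F^2\,\mathrm{tr}(I-F_k^2)-\mathrm{tr}(I-F_k)\,\mathrm{tr}((I-F_k^2)(I-F_k))}{D_k};$$ if $D_k=0$, set $\alpha_k=0$, $\beta_k=1$. Then $$X_{k+1}=X_k\big((\alpha_k+\beta_k)I+\beta_kF_k\big),\quad\text{so that}\quad F_{k+1}=(1-\alpha_k-\beta_k)I+\alpha_kF_k+\beta_kF_k^2 .$$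 Since $X_0=\alpha A^T$, all $F_k$ are real symmetric. The method is run without a stopping criterion. "SSHP2 converges" means $\lim_{k\to\infty}F_k=0$, equivalently $X_k\to A^{-1}$. *)

theory Defs
  imports "HOL-Analysis.Analysis"
begin

(* The library norm on real^'n^'n is the L2-norm of the L2-norms of the rows, i.e. the
   Frobenius norm (and not the operator norm). *)
abbreviation frobenius_norm :: "real^'n^'n \<Rightarrow> real" where
  "frobenius_norm M \<equiv> norm M"

definition spectral_norm :: "real^'n^'n \<Rightarrow> real" where
  "spectral_norm M = onorm ((*v) M)"

(* Eigenvalues in the field of the entries.  At type real this is the full spectrum for
   the matrices of the method, which are symmetric. *)
definition matrix_spectrum :: "'a::field^'n^'n \<Rightarrow> 'a set" where
  "matrix_spectrum M = {c. \<exists>v. v \<noteq> 0 \<and> M *v v = c *s v}"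

definition sshp2_D :: "real^'n^'n \<Rightarrow> real" where
  "sshp2_D F =
     (frobenius_norm (mat 1 - F))\<^sup>2 * (frobenius_norm (mat 1 - F ** F))\<^sup>2
     - (trace ((mat 1 - F ** F) ** (mat 1 - F)))\<^sup>2"

definition sshp2_alpha :: "real^'n^'n \<Rightarrow> real" where
  "sshp2_alpha F =
     (if sshp2_D F \<noteq> 0 then
        ((frobenius_norm (mat 1 - F ** F))\<^sup>2 * trace (mat 1 - F)
         - trace (mat 1 - F ** F) * trace ((mat 1 - F ** F) ** (mat 1 - F))) / sshp2_D F
      else 0)"

definition sshp2_beta :: "real^'n^'n \<Rightarrow> real" where
  "sshp2_beta F =
     (if sshp2_D F \<noteq> 0 then
        ((frobenius_norm (mat 1 - F))\<^sup>2 * trace (mat 1 - F ** F)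
         - trace (mat 1 - F) * trace ((mat 1 - F ** F) ** (mat 1 - F))) / sshp2_D F
      else 1)"

primrec sshp2_X :: "real^'n^'n \<Rightarrow> real^'n^'n \<Rightarrow> nat \<Rightarrow> real^'n^'n" where
  "sshp2_X A X0 0 = X0"
| "sshp2_X A X0 (Suc k) =
     (let X = sshp2_X A X0 k; F = mat 1 - A ** X; a = sshp2_alpha F; b = sshp2_beta F
      in X ** ((a + b) *\<^sub>R mat 1 + b *\<^sub>R F))"

definition sshp2_F :: "real^'n^'n \<Rightarrow> real^'n^'n \<Rightarrow> nat \<Rightarrow> real^'n^'n" where
  "sshp2_F A X0 k = mat 1 - A ** sshp2_X A X0 k"

definition sshp2_converges :: "real^'n^'n \<Rightarrow> real^'n^'n \<Rightarrow> bool" where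
  "sshp2_converges A X0 \<longleftrightarrow> sshp2_F A X0 \<longlonglongrightarrow> 0"

lemma sshp2_F_Suc:
  fixes A X0 :: "real^'n^'n" and k :: nat
  defines "F \<equiv> sshp2_F A X0 k"
  defines "a \<equiv> sshp2_alpha F" and "b \<equiv> sshp2_beta F"
  shows "sshp2_F A X0 (Suc k) = (1 - a - b) *\<^sub>R mat 1 + a *\<^sub>R F + b *\<^sub>R (F ** F)"
proof -
  have AX: "A ** sshp2_X A X0 k = mat 1 - F"
    by (simp add: F_def sshp2_F_def)
  have "sshp2_F A X0 (Suc k) = mat 1 - (mat 1 - F) ** ((a + b) *\<^sub>R mat 1 + b *\<^sub>R F)"
    by (simp add: sshp2_F_def[of _ _ "Suc k"] Let_def matrix_mul_assoc AX a_def b_def)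
  also have "\<dots> = (1 - a - b) *\<^sub>R mat 1 + a *\<^sub>R F + b *\<^sub>R (F ** F)"
  proof -
    have 1: "(mat 1 - F) ** M = M - F ** M" for M :: "real^'n^'n"
    proof -
      have "(mat 1 - F) ** M = mat 1 ** M - F ** M"
        by (simp add: matrix_matrix_mult_def vec_eq_iff left_diff_distrib sum_subtractf)
      then show ?thesis
        by simp
    qed
    have 2: "F ** (c *\<^sub>R M) = c *\<^sub>R (F ** M)" for c :: real and M :: "real^'n^'n"
      by (simp only: matrix_scalar_ac scalar_matrix_assoc)
    show ?thesis
      by (simp add: 1 2 matrix_add_ldistrib algebra_simps)
  qed
  finally show ?thesis .
qed

end

theory Submission
  imports Defs
begin

text \<open>
  An eigenvalue 1 of some \<open>F\<^sub>k\<close> persists, which rules out convergence. If \<open>F\<^sub>k \<rightarrow> 0\<close> and \<open>D\<^sub>k \<noteq> 0\<close>, then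
  \<open>F\<^sub>k\<^sub>+\<^sub>1 = p(F\<^sub>k)\<close> is the least-squares residual, so \<open>p\<close> is the quadratic orthogonal polynomial for the
  weight \<open>I - F\<^sub>k\<close>, scaled so that \<open>p(1) = 1\<close>. Its three-term form shows \<open>p(t) \<rightarrow> t\<^sup>2\<close> coefficientwise.

  Conversely, optimality against \<open>\<alpha> = \<beta> = 0\<close> bounds \<open>F\<^sub>k\<^sub>+\<^sub>1\<close> by the identity in Frobenius norm (for
  \<open>D\<^sub>k = 0\<close> the matrix \<open>F\<^sub>k\<close> is scalar and is squared). On an eigenvector of \<open>F\<^sub>0\<close> the method is a bounded
  scalar recursion asymptotic to \<open>x \<mapsto> x\<^sup>2\<close>: it is either trapped near the fixed point 0, or bounded
  away from 0, and then the distance to the repelling fixed point 1 grows geometrically, which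
  contradicts boundedness since 1 is never attained.
\<close>

section \<open>Frobenius norm estimates and the trace inner product\<close>

lemma matrix_norm_power2: "(norm (M::real^'n^'m))\<^sup>2 = (\<Sum>i\<in>UNIV. (norm (M$i))\<^sup>2)"
  by (simp add: norm_vec_def L2_set_def sum_nonneg)

lemma norm_transpose: "norm (transpose M) = norm (M::real^'n^'m)"
proof -
  have "(norm (transpose M))\<^sup>2 = (norm M)\<^sup>2"
    unfolding matrix_norm_power2
    by (simp add: norm_vec_def L2_set_def sum_nonneg transpose_def) (rule sum.swap)
  then show ?thesis by simp
qed

lemma norm_matrix_vector_mult_le: "norm (M *v x) \<le> norm M * norm x" for M :: "real^'n^'m"
proof (rule power2_le_imp_le)
  have "(norm (M *v x))\<^sup>2 = (\<Sum>i\<in>UNIV. (M$i \<bullet> x)\<^sup>2)"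
    by (simp add: norm_vec_def L2_set_def sum_nonneg matrix_vector_mul_component)
  also have "\<dots> \<le> (\<Sum>i\<in>UNIV. (norm (M$i))\<^sup>2 * (norm x)\<^sup>2)"
    by (intro sum_mono) (metis Cauchy_Schwarz_ineq power2_norm_eq_inner)
  also have "\<dots> = (norm M * norm x)\<^sup>2"
    by (simp add: matrix_norm_power2 power_mult_distrib sum_distrib_right)
  finally show "(norm (M *v x))\<^sup>2 \<le> (norm M * norm x)\<^sup>2" .
qed simp

lemma norm_matrix_matrix_mult_le: "norm (A ** B) \<le> norm A * norm B"
  for A :: "real^'n^'m" and B :: "real^'p^'n"
proof (rule power2_le_imp_le)
  have row: "(A ** B)$i = transpose B *v (A$i)" for i
    by (simp add: vec_eq_iff matrix_matrix_mult_def matrix_vector_mult_def transpose_def mult.commute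
        del: transpose_matrix_vector)
  have "(norm (A ** B))\<^sup>2 = (\<Sum>i\<in>UNIV. (norm (transpose B *v (A$i)))\<^sup>2)"
    unfolding matrix_norm_power2 row ..
  also have "\<dots> \<le> (\<Sum>i\<in>UNIV. (norm B * norm (A$i))\<^sup>2)"
    by (intro sum_mono power_mono order_trans[OF norm_matrix_vector_mult_le])
      (simp_all only: norm_transpose order_refl norm_ge_zero)
  also have "\<dots> = (norm A * norm B)\<^sup>2"
    by (simp only: power_mult_distrib sum_distrib_left[symmetric] matrix_norm_power2[of A, symmetric])
      (rule mult.commute)
  finally show "(norm (A ** B))\<^sup>2 \<le> (norm A * norm B)\<^sup>2" .
qed simp

text \<open>Supplies the linearity and limit rules for matrix products used throughout.\<close>

interpretation matrix_mult: bounded_bilinear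
  "(**) :: real^'n^'m \<Rightarrow> real^'p^'n \<Rightarrow> real^'p^'m"
proof
  show "\<exists>K. \<forall>(A::real^'n^'m) (B::real^'p^'n). norm (A ** B) \<le> norm A * norm B * K"
    by (rule exI[of _ 1]) (simp add: norm_matrix_matrix_mult_le)
qed (simp_all add: vec_eq_iff matrix_matrix_mult_def algebra_simps sum.distrib sum_distrib_left)

interpretation matrix_vector_mult: bounded_bilinear
  "(*v) :: real^'n^'m \<Rightarrow> real^'n \<Rightarrow> real^'m"
proof
  show "\<exists>K. \<forall>(A::real^'n^'m) (x::real^'n). norm (A *v x) \<le> norm A * norm x * K"
    by (rule exI[of _ 1]) (simp add: norm_matrix_vector_mult_le)
qed (simp_all add: vec_eq_iff matrix_vector_mult_def algebra_simps sum.distrib sum_distrib_left)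

lemma trace_eq_inner: "trace M = mat 1 \<bullet> (M::real^'n^'n)"
  by (simp add: trace_def inner_vec_def mat_def if_distrib[of "\<lambda>x. x * _"] cong: if_cong)

lemma trace_matrix_mult_eq_inner:
  "trace (M ** N) = M \<bullet> N" if "transpose N = N" for M N :: "real^'n^'n"
proof -
  have "trace (M ** N) = M \<bullet> transpose N"
    by (simp add: trace_def inner_vec_def matrix_matrix_mult_def transpose_def)
  then show ?thesis using that by simp
qed

lemma transpose_add: "transpose (A + B) = transpose A + transpose (B::real^'n^'m)"
  and transpose_diff: "transpose (A - B) = transpose A - transpose (B::real^'n^'m)"
  by (simp_all add: transpose_def vec_eq_iff)

lemma trace_scaleR: "trace (c *\<^sub>R M) = c * trace (M::real^'n^'n)"
  by (simp add: trace_def sum_distrib_left)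

lemma tendsto_trace [tendsto_intros]:
  "(f \<longlongrightarrow> M) F \<Longrightarrow> ((\<lambda>x. trace (f x)) \<longlongrightarrow> trace M) F" for M :: "real^'n^'n"
  unfolding trace_eq_inner by (intro tendsto_intros)

lemma symmetric_matrix_inner:
  "(F *v x) \<bullet> y = x \<bullet> (F *v y)" if "transpose F = F" for F :: "real^'n^'n"
  by (metis dot_lmul_matrix that transpose_matrix_vector)

section \<open>Least-squares optimality of one step\<close>

text \<open>\<open>sshp2_alpha\<close> and \<open>sshp2_beta\<close> are Cramer's rule for the 2x2
  Gram system of I - F and I - F^2, whose determinant is \<open>sshp2_D\<close>. Hence R is the
  residual of projecting I onto their span.\<close>

lemma normal_equations:
  fixes F :: "real^'n^'n"
  assumes "sshp2_D F \<noteq> 0" and sym: "transpose F = F"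
  defines "R \<equiv> mat 1 - sshp2_alpha F *\<^sub>R (mat 1 - F) - sshp2_beta F *\<^sub>R (mat 1 - F ** F)"
  shows "R \<bullet> (mat 1 - F) = 0" "R \<bullet> (mat 1 - F ** F) = 0"
proof -
  let ?Y = "mat 1 - F" and ?Z = "mat 1 - F ** F"
  define D y2 z2 yz ty tz where defs: "D = sshp2_D F" "y2 = (norm ?Y)\<^sup>2" "z2 = (norm ?Z)\<^sup>2"
    "yz = trace (?Z ** ?Y)" "ty = trace ?Y" "tz = trace ?Z"
  have D: "D = y2 * z2 - yz\<^sup>2" "D \<noteq> 0"
    using assms(1) by (simp_all add: defs sshp2_D_def)
  have a: "sshp2_alpha F = (z2 * ty - tz * yz) / D" and b: "sshp2_beta F = (y2 * tz - ty * yz) / D"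
    using assms(1) by (simp_all add: defs sshp2_alpha_def sshp2_beta_def)
  have yz: "?Z \<bullet> ?Y = yz"
    by (simp add: defs trace_matrix_mult_eq_inner transpose_diff sym)
  have expand: "(P - s *\<^sub>R Y - t *\<^sub>R Z) \<bullet> W = P \<bullet> W - s * (Y \<bullet> W) - t * (Z \<bullet> W)"
    for P Y Z W :: "real^'n^'n" and s t
    by (simp add: inner_diff_left)
  have "R \<bullet> ?Y = ty - sshp2_alpha F * y2 - sshp2_beta F * yz"
    unfolding R_def defs(2,5) trace_eq_inner power2_norm_eq_inner yz[symmetric]
    by (simp only: expand)
  also have "\<dots> = (D * ty - (z2 * ty - tz * yz) * y2 - (y2 * tz - ty * yz) * yz) / D"
    unfolding a b using D(2) by (simp add: divide_simps)
  also have "\<dots> = 0"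
    unfolding D(1) by (simp add: algebra_simps power2_eq_square)
  finally show "R \<bullet> ?Y = 0" .
  have "R \<bullet> ?Z = tz - sshp2_alpha F * yz - sshp2_beta F * z2"
    unfolding R_def defs(3,6) trace_eq_inner power2_norm_eq_inner yz[symmetric]
    by (simp only: expand inner_commute[of ?Y ?Z])
  also have "\<dots> = (D * tz - (z2 * ty - tz * yz) * yz - (y2 * tz - ty * yz) * z2) / D"
    unfolding a b using D(2) by (simp add: divide_simps)
  also have "\<dots> = 0"
    unfolding D(1) by (simp add: algebra_simps power2_eq_square)
  finally show "R \<bullet> ?Z = 0" .
qed

text \<open>The recursion on F alone, freed from A and X.\<close>

definition sshp2_step :: "real^'n^'n \<Rightarrow> real^'n^'n" where
  "sshp2_step F = (1 - sshp2_alpha F - sshp2_beta F) *\<^sub>R mat 1 + sshp2_alpha F *\<^sub>R F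
     + sshp2_beta F *\<^sub>R (F ** F)"

lemma sshp2_step_residual:
  "sshp2_step F = mat 1 - sshp2_alpha F *\<^sub>R (mat 1 - F) - sshp2_beta F *\<^sub>R (mat 1 - F ** F)"
  by (simp add: sshp2_step_def algebra_simps)

lemma transpose_sshp2_step:
  "transpose F = F \<Longrightarrow> transpose (sshp2_step F) = sshp2_step F"
  by (simp add: sshp2_step_def transpose_add transpose_scalar matrix_transpose_mul)

text \<open>A projection residual R of I satisfies <R, R> = <R, I>; Cauchy-Schwarz then gives the
  bound.\<close>

lemma norm_sshp2_step_le_of_D:
  fixes F :: "real^'n^'n"
  assumes "sshp2_D F \<noteq> 0" and "transpose F = F"
  shows "norm (sshp2_step F) \<le> norm (mat 1 :: real^'n^'n)"
proof -
  let ?R = "sshp2_step F"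
  have "?R \<bullet> ?R = ?R \<bullet> mat 1 - sshp2_alpha F * (?R \<bullet> (mat 1 - F))
      - sshp2_beta F * (?R \<bullet> (mat 1 - F ** F))"
    by (subst (2) sshp2_step_residual) (simp only: inner_diff_right inner_scaleR_right)
  then have "?R \<bullet> ?R = ?R \<bullet> mat 1"
    using normal_equations[OF assms] by (simp only: sshp2_step_residual mult_zero_right diff_zero)
  then have "norm ?R * norm ?R \<le> norm ?R * norm (mat 1 :: real^'n^'n)"
    by (metis norm_cauchy_schwarz power2_eq_square power2_norm_eq_inner)
  then show ?thesis
    by (metis mult_le_cancel_left norm_ge_zero order_le_less)
qed

section \<open>The degenerate case D = 0\<close>

lemma sshp2_D_scalar: "sshp2_D (c *\<^sub>R mat 1 :: real^'n^'n) = 0"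
proof -
  have 1: "mat 1 - c *\<^sub>R mat 1 = (1 - c) *\<^sub>R (mat 1::real^'n^'n)"
    by (simp add: algebra_simps)
  have 2: "mat 1 - (c *\<^sub>R mat 1) ** (c *\<^sub>R mat 1) = (1 - c\<^sup>2) *\<^sub>R (mat 1::real^'n^'n)"
    by (simp add: matrix_mult.scaleR_left matrix_mult.scaleR_right algebra_simps power2_eq_square)
  have "(norm (mat 1 :: real^'n^'n))\<^sup>2 = real CARD('n)"
    by (simp only: power2_norm_eq_inner trace_eq_inner[symmetric] trace_I)
  then show ?thesis
    unfolding sshp2_D_def 1 2
    by (simp add: matrix_mult.scaleR_left matrix_mult.scaleR_right trace_scaleR trace_I
        power_mult_distrib power2_abs)
      (simp add: power2_eq_square)
qed

text \<open>D = 0 is equality in Cauchy-Schwarz for I - F and I - F^2, so I - F^2 = e (I - F).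
  Without the eigenvalue 1 the factor I - F is injective and cancels, leaving I + F = e I.\<close>

lemma sshp2_D_eq_0_imp_scalar:
  assumes D: "sshp2_D F = 0" and sym: "transpose F = F" and spec: "1 \<notin> matrix_spectrum F"
  obtains c where "F = c *\<^sub>R (mat 1 :: real^'n^'n)"
proof -
  let ?Y = "mat 1 - F" and ?Z = "mat 1 - F ** F"
  have inj: "v = 0" if "?Y *v v = 0" for v
    using that spec by (auto simp: matrix_spectrum_def matrix_vector_mult_diff_rdistrib)
  have Y: "?Y \<noteq> 0"
  proof
    assume "?Y = 0"
    then have "axis undefined 1 = (0::real^'n)" using inj by simp
    then show False by (simp add: axis_eq_0_iff)
  qed
  have "(?Z \<bullet> ?Y)\<^sup>2 = (norm ?Z * norm ?Y)\<^sup>2"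
    using D by (simp add: sshp2_D_def trace_matrix_mult_eq_inner transpose_diff sym
        power_mult_distrib mult.commute)
  then have "\<bar>?Z \<bullet> ?Y\<bar> = norm ?Z * norm ?Y"
    by (subst power2_eq_iff_nonneg[symmetric]) simp_all
  then have "norm ?Z *\<^sub>R ?Y = norm ?Y *\<^sub>R ?Z \<or> norm ?Z *\<^sub>R ?Y = - norm ?Y *\<^sub>R ?Z"
    by (simp only: norm_cauchy_schwarz_abs_eq)
  then obtain d where "d *\<^sub>R ?Y = norm ?Y *\<^sub>R ?Z"
  proof
    assume "norm ?Z *\<^sub>R ?Y = - norm ?Y *\<^sub>R ?Z"
    then have "(- norm ?Z) *\<^sub>R ?Y = norm ?Y *\<^sub>R ?Z"
      by (simp only: scaleR_minus_left minus_equation_iff minus_minus)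
    then show thesis by (rule that)
  qed (rule that)
  then have "(d / norm ?Y) *\<^sub>R ?Y = (norm ?Y / norm ?Y) *\<^sub>R ?Z"
    by (simp only: divide_inverse_commute scaleR_scaleR[symmetric])
  then obtain e where e: "?Z = e *\<^sub>R ?Y"
    using Y by (metis divide_self norm_eq_zero scaleR_one)
  have "F *v x = ((e - 1) *\<^sub>R mat 1) *v x" for x
  proof -
    have "?Y ** (F - (e - 1) *\<^sub>R mat 1) = ?Z - e *\<^sub>R ?Y"
      by (simp add: matrix_mult.diff_left matrix_mult.diff_right matrix_mult.add_right
          matrix_mult.scaleR_right algebra_simps)
    then have "?Y *v ((F - (e - 1) *\<^sub>R mat 1) *v x) = 0"
      by (simp only: e matrix_vector_mul_assoc) simp
    then have "(F - (e - 1) *\<^sub>R mat 1) *v x = 0" by (rule inj)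
    then show ?thesis by (simp add: matrix_vector_mult_diff_rdistrib)
  qed
  then have "F = (e - 1) *\<^sub>R mat 1" unfolding matrix_eq by blast
  then show thesis by (rule that)
qed

section \<open>The perturbed squaring recursion on the real line\<close>

lemma scalar_recurrence_tendsto_0:
  fixes x a b :: "nat \<Rightarrow> real"
  assumes rec: "\<And>k. x (Suc k) = (1 - a k - b k) + a k * x k + b k * (x k)\<^sup>2"
    and bdd: "\<And>k. \<bar>x k\<bar> \<le> C" and neq1: "\<And>k. x k \<noteq> 1"
    and a: "a \<longlonglongrightarrow> 0" and b: "b \<longlonglongrightarrow> 1"
  shows "x \<longlonglongrightarrow> 0"
proof -
  define e where "e k = x (Suc k) - (x k)\<^sup>2" for k
  have "e \<longlonglongrightarrow> 0"
  proof (rule Lim_null_comparison)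
    have C: "\<bar>x k ^ 2\<bar> \<le> C\<^sup>2" for k
      using power_mono[OF bdd[of k], of 2] by simp
    show "\<forall>\<^sub>F k in sequentially. norm (e k) \<le> \<bar>1 - a k - b k\<bar> + \<bar>a k\<bar> * C + \<bar>b k - 1\<bar> * C\<^sup>2"
    proof (rule always_eventually, rule allI)
      fix k
      have "e k = (1 - a k - b k) + a k * x k + (b k - 1) * (x k)\<^sup>2"
        unfolding e_def rec by (simp add: algebra_simps)
      then show "norm (e k) \<le> \<bar>1 - a k - b k\<bar> + \<bar>a k\<bar> * C + \<bar>b k - 1\<bar> * C\<^sup>2"
        using mult_left_mono[OF bdd[of k], of "\<bar>a k\<bar>"] mult_left_mono[OF C[of k], of "\<bar>b k - 1\<bar>"]
          abs_triangle_ineq[of "1 - a k - b k + a k * x k" "(b k - 1) * (x k)\<^sup>2"]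
          abs_triangle_ineq[of "1 - a k - b k" "a k * x k"]
        by (simp add: abs_mult)
    qed
    show "(\<lambda>k. \<bar>1 - a k - b k\<bar> + \<bar>a k\<bar> * C + \<bar>b k - 1\<bar> * C\<^sup>2) \<longlonglongrightarrow> 0"
      by (rule tendsto_eq_intros a b refl | simp)+
  qed
  have small: "\<forall>\<^sub>F k in sequentially. \<bar>e k\<bar> < d" if "d > 0" for d
    using tendstoD[OF \<open>e \<longlonglongrightarrow> 0\<close> that] by simp
  \<comment> \<open>The threshold 1/4 = (1/2)^2 serves twice: from |x| \<le> 1/2 the next iterate
    stays within 1/2, and from |x| > 1/2 the square outweighs the error, so the next iterate is
    positive.\<close>
  obtain K where K: "\<And>k. k \<ge> K \<Longrightarrow> \<bar>e k\<bar> < 1/4"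
    using small[of "1/4"] by (auto simp: eventually_sequentially)
  have step: "\<bar>x (Suc k)\<bar> \<le> \<bar>x k\<bar> / 2 + \<bar>e k\<bar>" if "\<bar>x k\<bar> \<le> 1/2" for k
  proof -
    have "(x k)\<^sup>2 \<le> \<bar>x k\<bar> / 2"
      using mult_left_mono[OF that, of "\<bar>x k\<bar>"] by (simp add: power2_eq_square abs_mult[symmetric])
    then show ?thesis
      using zero_le_power2[of "x k"] unfolding e_def by linarith
  qed
  have trapped: "\<exists>N\<ge>K. \<bar>x N\<bar> \<le> 1/2"
  proof (rule ccontr)
    assume "\<not> ?thesis"
    then have big: "\<And>k. k \<ge> K \<Longrightarrow> \<bar>x k\<bar> > 1/2" by force
    have pos: "x (Suc k) > 1/2" if "k \<ge> K" for k
    proof -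
      have "(1/2)\<^sup>2 < \<bar>x k\<bar>\<^sup>2"
        using big[OF that] by (intro power_strict_mono) simp_all
      then have "(x k)\<^sup>2 > 1/4"
        by (simp add: power2_eq_square)
      then have "x (Suc k) > 0"
        using K[OF that] unfolding e_def by linarith
      then show ?thesis using big[of "Suc k"] that by simp
    qed
    \<comment> \<open>The fixed point 1 is repelling: near the limit map its multiplier is close to 2.\<close>
    have "\<forall>\<^sub>F k in sequentially. \<bar>a k\<bar> < 1/10 \<and> \<bar>b k - 1\<bar> < 1/10"
      using tendstoD[OF a, of "1/10"] tendstoD[OF b, of "1/10"]
      by (simp add: dist_real_def eventually_conj)
    then obtain L where L: "\<And>k. k \<ge> L \<Longrightarrow> \<bar>a k\<bar> < 1/10 \<and> \<bar>b k - 1\<bar> < 1/10"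
      by (auto simp: eventually_sequentially)
    \<comment> \<open>The successor is there because \<open>pos\<close> speaks of x (Suc k), so k -
      1 must still be at least K.\<close>
    define M where "M = Suc (max K L)"
    have grow: "\<bar>1 - x (Suc k)\<bar> \<ge> 5/4 * \<bar>1 - x k\<bar>" if "k \<ge> M" for k
    proof -
      have "k = Suc (k - 1)" "k - 1 \<ge> K" "k \<ge> L" using that by (auto simp: M_def)
      then have xk: "x k > 1/2" and ab: "\<bar>a k\<bar> < 1/10" "\<bar>b k - 1\<bar> < 1/10"
        using pos[of "k - 1"] L[of k] by auto
      have "9/10 \<le> b k" using ab by linarith
      \<comment> \<open>The map factors as 1 - x (Suc k) = (a k + b k (1 + x k)) (1 - x k), and the
        first factor is at least 27/20 - 1/10 = 5/4.\<close>
      have "(9/10) * (3/2) \<le> b k * (1 + x k)"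
        using xk \<open>9/10 \<le> b k\<close> by (intro mult_mono) auto
      then have "\<bar>a k + b k * (1 + x k)\<bar> \<ge> 5/4" using ab by linarith
      then have "5/4 * \<bar>1 - x k\<bar> \<le> \<bar>a k + b k * (1 + x k)\<bar> * \<bar>1 - x k\<bar>"
        by (intro mult_right_mono) auto
      also have "\<dots> = \<bar>1 - x (Suc k)\<bar>"
        unfolding rec abs_mult[symmetric] by (simp add: algebra_simps power2_eq_square)
      finally show ?thesis .
    qed
    have geo: "\<bar>1 - x (M + j)\<bar> \<ge> (5/4) ^ j * \<bar>1 - x M\<bar>" for j
    proof (induction j)
      case (Suc j)
      then show ?case using grow[of "M + j"] by simp
    qed simp
    have "\<bar>1 - x M\<bar> > 0" using neq1[of M] by simp
    obtain j where "(1 + C) / \<bar>1 - x M\<bar> < (5/4) ^ j"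
      using real_arch_pow[of "5/4" "(1 + C) / \<bar>1 - x M\<bar>"] by auto
    then have "1 + C < (5/4) ^ j * \<bar>1 - x M\<bar>"
      using \<open>\<bar>1 - x M\<bar> > 0\<close> by (simp add: field_simps)
    with geo[of j] bdd[of "M + j"] show False by linarith
  qed
  then obtain N where N: "N \<ge> K" "\<bar>x N\<bar> \<le> 1/2" by blast
  have half: "\<bar>x k\<bar> \<le> 1/2" if "k \<ge> N" for k
    using that
  proof (induction k rule: dec_induct)
    case (step k)
    then show ?case using \<open>\<bar>x k\<bar> \<le> 1/2 \<Longrightarrow> \<bar>x (Suc k)\<bar> \<le> \<bar>x k\<bar> / 2 + \<bar>e k\<bar>\<close> K[of k] N by auto
  qed (rule N)
  show ?thesis
  proof (rule LIMSEQ_I)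
    fix r :: real assume "r > 0"
    then obtain P where P: "\<And>k. k \<ge> P \<Longrightarrow> \<bar>e k\<bar> < r / 4"
      using small[of "r/4"] by (auto simp: eventually_sequentially)
    define Q where "Q = max N P"
    \<comment> \<open>r / 2 is the fixed point of y \<mapsto> y / 2 + r / 4, so the accumulated
      errors never exceed it.\<close>
    have decay: "\<bar>x (Q + j)\<bar> \<le> (1/2) ^ j + r / 2" for j
    proof (induction j)
      case 0
      then show ?case using half[of Q] \<open>r > 0\<close> by (simp add: Q_def)
    next
      case (Suc j)
      have "Q + j \<ge> N" "Q + j \<ge> P" by (auto simp: Q_def)
      with Suc show ?case
        using step[OF half, of "Q + j"] P[of "Q + j"] by simp
    qed
    obtain j where j: "(1/2) ^ j < r / 2"
      using real_arch_pow_inv[of "r/2" "1/2"] \<open>r > 0\<close> by auto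
    show "\<exists>n0. \<forall>n\<ge>n0. norm (x n - 0) < r"
    proof (intro exI allI impI)
      fix n assume n: "n \<ge> Q + j"
      have "(1/2::real) ^ (n - Q) \<le> (1/2) ^ j"
        using n by (intro power_decreasing) auto
      moreover have "\<bar>x n\<bar> \<le> (1/2) ^ (n - Q) + r / 2"
        using decay[of "n - Q"] n by simp
      ultimately show "norm (x n - 0) < r"
        using j unfolding diff_zero real_norm_def by linarith
    qed
  qed
qed

section \<open>Spectral theorem for symmetric matrices and limits on eigenvectors\<close>

text \<open>A maximiser of the Rayleigh quotient on the unit sphere of V is an eigenvector. A
  general invariant V is allowed so that the result applies to an orthogonal complement.\<close>

lemma symmetric_matrix_eigenvector:
  fixes F :: "real^'n^'n"
  assumes sym: "transpose F = F" and V: "subspace V" "V \<noteq> {0}"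
    and inv: "\<And>v. v \<in> V \<Longrightarrow> F *v v \<in> V"
  obtains v c where "v \<in> V" "v \<noteq> 0" "F *v v = c *\<^sub>R v"
proof -
  let ?S = "V \<inter> sphere 0 1"
  obtain w where w: "w \<in> V" "w \<noteq> 0"
    using V subspace_0 by fastforce
  have "w /\<^sub>R norm w \<in> ?S"
    using w V by (simp add: subspace_scale)
  moreover have "compact ?S"
    by (intro closed_Int_compact closed_subspace V compact_sphere)
  moreover have "continuous_on ?S (\<lambda>x. (F *v x) \<bullet> x)"
    by (intro continuous_intros linear_continuous_on) simp
  ultimately obtain v where v: "v \<in> ?S" and max: "\<And>y. y \<in> ?S \<Longrightarrow> (F *v y) \<bullet> y \<le> (F *v v) \<bullet> v"
    using continuous_attains_sup[of ?S "\<lambda>x. (F *v x) \<bullet> x"] by blast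
  define c where "c = (F *v v) \<bullet> v"
  define q where "q y = c * (y \<bullet> y) - (F *v y) \<bullet> y" for y
  have vv: "v \<bullet> v = 1" "v \<in> V" "v \<noteq> 0"
    using v by (auto simp: norm_eq_1)
  have q_nonneg: "q y \<ge> 0" if "y \<in> V" for y
  proof (cases "y = 0")
    case False
    then have "y /\<^sub>R norm y \<in> ?S" using that V by (simp add: subspace_scale)
    then have "(F *v (y /\<^sub>R norm y)) \<bullet> (y /\<^sub>R norm y) \<le> c"
      unfolding c_def by (rule max)
    then have "(F *v y) \<bullet> y / (norm y)\<^sup>2 \<le> c"
      by (simp add: matrix_vector_mult_scaleR power2_eq_square divide_inverse ac_simps)
    then show ?thesis
      using False by (simp add: q_def power2_norm_eq_inner divide_le_eq)
  qed (simp add: q_def)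
  define r where "r = c *\<^sub>R v - F *v v"
  have "r \<in> V"
    unfolding r_def using V vv inv by (intro subspace_diff subspace_scale)
  \<comment> \<open>First-order condition: the nonnegative form \<open>q\<close> vanishes at \<open>v\<close>, so its derivative
    \<open>2 r \<bullet> z\<close> in direction \<open>z = r\<close> vanishes there.\<close>
  have q_line: "q (v + t *\<^sub>R r) = 2 * t * (r \<bullet> r) + t\<^sup>2 * q r" for t
  proof -
    have "(F *v r) \<bullet> v = (F *v v) \<bullet> r"
      by (metis inner_commute symmetric_matrix_inner[OF sym])
    then have "q (v + t *\<^sub>R r) = q v + 2 * t * ((c *\<^sub>R v - F *v v) \<bullet> r) + t\<^sup>2 * q r"
      unfolding q_def
      by (simp add: algebra_simps matrix_vector_mult_scaleR matrix_vector_right_distrib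
          inner_add_left inner_add_right inner_diff_left power2_eq_square inner_commute[of r v])
    then show ?thesis by (simp add: r_def[symmetric]) (simp add: q_def c_def vv)
  qed
  have "r = 0"
  proof (rule ccontr)
    assume "r \<noteq> 0"
    then have rr: "r \<bullet> r > 0" by simp
    have qr: "q r \<ge> 0" using q_nonneg[OF \<open>r \<in> V\<close>] .
    \<comment> \<open>A small negative t makes the linear term 2 t (r \<bullet> r) dominate t^2 q r;
      the 1 in the denominator covers q r = 0.\<close>
    define t where "t = - (r \<bullet> r) / (1 + q r)"
    have "t < 0"
      unfolding t_def using rr qr by (intro divide_neg_pos) simp_all
    have "0 \<le> q (v + t *\<^sub>R r)"
      by (intro q_nonneg subspace_add subspace_scale V vv \<open>r \<in> V\<close>)
    also have "\<dots> = t * (r \<bullet> r) + t * ((r \<bullet> r) + t * q r)"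
      unfolding q_line by (simp add: algebra_simps power2_eq_square)
    also have "(r \<bullet> r) + t * q r = (r \<bullet> r) / (1 + q r)"
      using qr by (simp add: t_def field_simps)
    also have "t * (r \<bullet> r) + t * ((r \<bullet> r) / (1 + q r)) < 0"
      using rr qr \<open>t < 0\<close> by (intro add_neg_neg mult_neg_pos) simp_all
    finally show False by simp
  qed
  then have "F *v v = c *\<^sub>R v" by (simp add: r_def)
  with vv show thesis by (intro that)
qed

text \<open>The orthogonal complement of all eigenvectors is invariant; were it nonzero, it would
  contain an eigenvector, which would be orthogonal to itself.\<close>

lemma symmetric_matrix_span_eigenvectors:
  fixes F :: "real^'n^'n"
  assumes sym: "transpose F = F"
  shows "span {v. \<exists>c. F *v v = c *\<^sub>R v} = UNIV" (is "span ?E = UNIV")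
proof (rule ccontr)
  let ?V = "{z. \<forall>w\<in>?E. w \<bullet> z = 0}"
  assume "span ?E \<noteq> UNIV"
  then obtain x where "x \<notin> span ?E" by blast
  obtain y z where yz: "y \<in> span ?E" "\<And>w. w \<in> span ?E \<Longrightarrow> orthogonal z w" "x = y + z"
    using orthogonal_subspace_decomp_exists by blast
  then have "z \<in> ?V" "z \<noteq> 0"
    using \<open>x \<notin> span ?E\<close> by (auto simp: orthogonal_def span_base inner_commute)
  moreover have "subspace ?V"
    by (auto simp: subspace_def inner_add_right)
  moreover have "F *v v \<in> ?V" if "v \<in> ?V" for v
    using that by (auto simp: symmetric_matrix_inner[OF sym, symmetric])
  ultimately obtain v c where "v \<in> ?V" "v \<noteq> 0" "F *v v = c *\<^sub>R v"
    using symmetric_matrix_eigenvector[OF sym, of ?V] by blast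
  then have "v \<bullet> v = 0" by blast
  with \<open>v \<noteq> 0\<close> show False by simp
qed

text \<open>Reduces matrix convergence to one eigenvector at a time: images of all vectors converge
  by linearity, and entries are components of images of basis vectors.\<close>

lemma tendsto_matrix_0I:
  fixes F :: "nat \<Rightarrow> real^'n^'n"
  assumes "\<And>v. v \<in> S \<Longrightarrow> (\<lambda>k. F k *v v) \<longlonglongrightarrow> 0" and "span S = UNIV"
  shows "F \<longlonglongrightarrow> 0"
proof -
  have lim: "(\<lambda>k. F k *v v) \<longlonglongrightarrow> 0" for v
  proof -
    have "v \<in> span S" using assms(2) by simp
    then show ?thesis
    proof (induction rule: span_induct_alt)
      case (step c x y)
      have "(\<lambda>k. c *\<^sub>R (F k *v x) + F k *v y) \<longlonglongrightarrow> c *\<^sub>R 0 + 0"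
        by (intro tendsto_intros assms step)
      then show ?case by (simp add: matrix_vector_right_distrib matrix_vector_mult_scaleR)
    qed simp
  qed
  have "F k $ i $ j = (F k *v axis j 1) $ i" for k i j
    by (simp add: matrix_vector_mult_basis column_def)
  then have "(\<lambda>k. F k $ i $ j) \<longlonglongrightarrow> 0" for i j
    using tendsto_vec_nth[OF lim[of "axis j 1"], of i] by simp
  then show ?thesis
    by (intro vec_tendstoI) simp_all
qed

text \<open>A step is a polynomial in F, so eigenvectors of F survive it and the eigenvectors of the
  initial residual serve all later ones.\<close>

lemma sshp2_step_eigenvector:
  assumes "F *v v = c *\<^sub>R v"
  shows "sshp2_step F *v v = ((1 - sshp2_alpha F - sshp2_beta F) + sshp2_alpha F * c
    + sshp2_beta F * c\<^sup>2) *\<^sub>R v"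
proof -
  have "F *v (F *v v) = (c\<^sup>2) *\<^sub>R v"
    by (simp add: assms matrix_vector_mult_scaleR power2_eq_square)
  then show ?thesis
    by (simp add: sshp2_step_def matrix_vector_mult.add_left matrix_vector_mult.scaleR_left
      matrix_vector_mul_assoc[symmetric] assms scaleR_add_left del: scaleR_left_diff_distrib
      matrix_vector_mul_assoc)
qed

section \<open>Centred moments and the limits of the parameters\<close>

text \<open>In the moments \<open>\<tau> j = trace ((I - F) ** F\<^sup>j)\<close> and the centre \<open>m = \<tau> 1 / \<tau> 0\<close>, the least-squares
  quadratic is \<open>b ((t - m)\<^sup>2 - \<kappa> (t - m) - Q2 / \<tau> 0)\<close>, the orthogonal polynomial of degree two for
  the weight \<open>I - F\<close>, normalised to take the value 1 at 1.\<close>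

lemma centred_normal_equations:
  fixes a b :: real
  assumes "t0 \<noteq> 0" and Q2: "Q2 \<noteq> 0"
    and E1: "(1 - a - b) * t0 + a * t1 + b * t2 = 0"
    and E2: "(1 - a - b) * t1 + a * t2 + b * t3 = 0"
    and m: "m = t1 / t0" and "Q2 = t2 - 2 * m * t1 + m\<^sup>2 * t0"
    and "Q3 = t3 - 3 * m * t2 + 3 * m\<^sup>2 * t1 - m ^ 3 * t0"
    and k: "\<kappa> = Q3 / Q2"
  shows "b * ((1 - m) * (1 - m - \<kappa>) - Q2 / t0) = 1" and "a = b * (- 2 * m - \<kappa>)"
proof -
  have t1: "t1 = m * t0" using assms by simp
  have Q: "Q2 = t2 - m\<^sup>2 * t0" "Q3 = t3 - 3 * m * t2 + 2 * m ^ 3 * t0"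
    using assms(6,7) by (simp_all add: t1 power2_eq_square power3_eq_cube algebra_simps)
  \<comment> \<open>Orthogonality of the quadratic to t - m: the first moment about m vanishes, so
    its constant term drops out.\<close>
  have "b * Q3 + (a + 2 * b * m) * Q2 = ((1 - a - b) * t1 + a * t2 + b * t3)
      - m * ((1 - a - b) * t0 + a * t1 + b * t2)"
    unfolding t1 Q by (simp add: power2_eq_square power3_eq_cube algebra_simps)
  then have "b * Q3 + (a + 2 * b * m) * Q2 = 0" by (simp only: E1 E2 mult_zero_right diff_zero)
  moreover have "Q3 = \<kappa> * Q2" using k Q2 by simp
  ultimately have "(b * \<kappa> + a + 2 * b * m) * Q2 = 0" by (simp add: algebra_simps)
  with Q2 have "b * \<kappa> + a + 2 * b * m = 0" by (simp only: mult_eq_0_iff) simp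
  then show a: "a = b * (- 2 * m - \<kappa>)" by (simp add: algebra_simps)
  \<comment> \<open>Orthogonality to 1, with the quadratic expanded about m; the first-order term
    vanishes again.\<close>
  have "(1 - a - b + a * m + b * m\<^sup>2) * t0 + b * Q2 = 0"
    using E1 unfolding t1 Q by (simp add: algebra_simps power2_eq_square)
  then have "1 - a - b + a * m + b * m\<^sup>2 + b * (Q2 / t0) = 0"
    using \<open>t0 \<noteq> 0\<close> by (simp add: field_simps)
  then show "b * ((1 - m) * (1 - m - \<kappa>) - Q2 / t0) = 1"
    unfolding a by (simp add: algebra_simps power2_eq_square)
qed

definition centre :: "real^'n^'n \<Rightarrow> real" where
  "centre F = trace ((mat 1 - F) ** F) / trace (mat 1 - F)"

definition centred :: "real^'n^'n \<Rightarrow> real^'n^'n" where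
  "centred F = F - centre F *\<^sub>R mat 1"

text \<open>Kept as a product with \<open>centred F\<close>, not expanded in powers of F, so that
  norm estimates show its order in \<open>centred F\<close>.\<close>

definition moment2 :: "real^'n^'n \<Rightarrow> real" where
  "moment2 F = trace ((mat 1 - F) ** (centred F ** centred F))"

definition moment3 :: "real^'n^'n \<Rightarrow> real" where
  "moment3 F = trace ((mat 1 - F) ** (centred F ** (centred F ** centred F)))"

lemma transpose_centred: "transpose F = F \<Longrightarrow> transpose (centred F) = centred F"
  by (simp add: centred_def transpose_diff transpose_scalar)

text \<open>For \<open>norm F < 1\<close> this makes the second moment comparable to the squared
  norm of \<open>centred F\<close>, so it can serve as a denominator.\<close>

lemma moment2_ge:
  fixes F :: "real^'n^'n"
  assumes sym: "transpose F = F"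
  shows "(1 - norm F) * (norm (centred F))\<^sup>2 \<le> moment2 F"
proof -
  let ?G = "centred F"
  have "transpose (?G ** ?G) = ?G ** ?G"
    by (simp add: matrix_transpose_mul transpose_centred[OF sym])
  then have "moment2 F = ?G \<bullet> ?G - F \<bullet> (?G ** ?G)"
    by (simp add: moment2_def matrix_mult.diff_left trace_sub trace_matrix_mult_eq_inner
        transpose_centred[OF sym])
  moreover have "F \<bullet> (?G ** ?G) \<le> norm F * (norm ?G)\<^sup>2"
    by (rule order_trans[OF norm_cauchy_schwarz])
      (simp add: mult_left_mono norm_matrix_matrix_mult_le power2_eq_square)
  ultimately show ?thesis
    by (simp add: power2_norm_eq_inner left_diff_distrib)
qed

lemma abs_moment3_le:
  fixes F :: "real^'n^'n"
  assumes sym: "transpose F = F"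
  shows "\<bar>moment3 F\<bar> \<le> norm (mat 1 - F) * norm (centred F) * (norm (centred F))\<^sup>2"
proof -
  let ?G = "centred F"
  have "transpose (?G ** (?G ** ?G)) = ?G ** (?G ** ?G)"
    by (simp add: matrix_transpose_mul transpose_centred[OF sym] matrix_mul_assoc)
  then have "\<bar>moment3 F\<bar> \<le> norm (mat 1 - F) * norm (?G ** (?G ** ?G))"
    unfolding moment3_def by (simp only: trace_matrix_mult_eq_inner Cauchy_Schwarz_ineq2)
  also have "norm (?G ** (?G ** ?G)) \<le> norm ?G * (norm ?G * norm ?G)"
    by (rule order_trans[OF norm_matrix_matrix_mult_le])
      (simp add: mult_left_mono norm_matrix_matrix_mult_le)
  finally show ?thesis
    by (simp add: mult_left_mono power2_eq_square mult.assoc)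
qed

text \<open>Both moments may tend to 0, but the numerator is cubic and the denominator quadratic in
  \<open>centred F\<close>, so the ratio is at most of first order.\<close>

lemma abs_moment_ratio_le:
  fixes F :: "real^'n^'n"
  assumes sym: "transpose F = F" and "norm F < 1"
  shows "\<bar>moment3 F / moment2 F\<bar> \<le> norm (mat 1 - F) * norm (centred F) / (1 - norm F)"
proof (cases "centred F = 0")
  case True
  then show ?thesis by (simp add: moment3_def trace_def)
next
  case False
  let ?g = "(norm (centred F))\<^sup>2"
  have g: "(1 - norm F) * ?g > 0" using False assms by simp
  have "\<bar>moment3 F / moment2 F\<bar> \<le> (norm (mat 1 - F) * norm (centred F) * ?g) / ((1 - norm F) * ?g)"
    unfolding abs_divide using moment2_ge[OF sym] g
    by (intro frac_le abs_moment3_le[OF sym]) auto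
  then show ?thesis using False by simp
qed

text \<open>As F tends to 0, the defining quotients of both parameters become 0/0. These identities
  replace them by m, \<kappa> and the second moment, which have limits.\<close>

lemma sshp2_parameters_centred:
  fixes F :: "real^'n^'n"
  assumes D: "sshp2_D F \<noteq> 0" and sym: "transpose F = F" and "norm F < 1"
    and tr: "trace (mat 1 - F) \<noteq> 0"
  defines "m \<equiv> centre F" and "\<kappa> \<equiv> moment3 F / moment2 F"
  shows "sshp2_beta F * ((1 - m) * (1 - m - \<kappa>) - moment2 F / trace (mat 1 - F)) = 1"
    and "sshp2_alpha F = sshp2_beta F * (- 2 * m - \<kappa>)"
proof -
  let ?Y = "mat 1 - F" and ?R = "sshp2_step F" and ?a = "sshp2_alpha F" and ?b = "sshp2_beta F"
  let ?t0 = "trace ?Y" and ?t1 = "trace (?Y ** F)" and ?t2 = "trace (?Y ** (F ** F))"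
    and ?t3 = "trace (?Y ** (F ** (F ** F)))"
  note expand = matrix_mult.diff_left matrix_mult.diff_right matrix_mult.add_left
    matrix_mult.add_right matrix_mult.scaleR_left matrix_mult.scaleR_right
    matrix_mul_assoc[symmetric]
  have RY: "?R \<bullet> ?Y = 0" and RZ: "?R \<bullet> (mat 1 - F ** F) = 0"
    using normal_equations[OF D sym] by (simp_all only: sshp2_step_residual)
  \<comment> \<open>Since (I - F) F lies in the span of I - F and I - F^2, the normal equations say
    that the quadratic is orthogonal to 1 and t for the weight I - F.\<close>
  have YF: "?Y ** F = (mat 1 - F ** F) - ?Y"
    by (simp add: expand)
  have RYF: "?R \<bullet> (?Y ** F) = 0"
    by (simp only: YF inner_diff_right[of ?R "mat 1 - F ** F" ?Y] RY RZ diff_zero)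
  have tYF: "transpose (?Y ** F) = ?Y ** F"
    by (simp add: YF transpose_diff matrix_transpose_mul sym)
  have "0 = trace (?R ** ?Y)"
    using RY by (simp add: trace_matrix_mult_eq_inner transpose_diff sym)
  also have "?R ** ?Y = (1 - ?a - ?b) *\<^sub>R ?Y + ?a *\<^sub>R (?Y ** F) + ?b *\<^sub>R (?Y ** (F ** F))"
    by (simp add: sshp2_step_def expand algebra_simps)
  finally have E1: "(1 - ?a - ?b) * ?t0 + ?a * ?t1 + ?b * ?t2 = 0"
    by (simp only: trace_add trace_scaleR)
  have "0 = trace (?R ** (?Y ** F))"
    using RYF tYF by (simp add: trace_matrix_mult_eq_inner)
  also have "?R ** (?Y ** F) = (1 - ?a - ?b) *\<^sub>R (?Y ** F) + ?a *\<^sub>R (?Y ** (F ** F))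
      + ?b *\<^sub>R (?Y ** (F ** (F ** F)))"
    by (simp add: sshp2_step_def expand algebra_simps)
  finally have E2: "(1 - ?a - ?b) * ?t1 + ?a * ?t2 + ?b * ?t3 = 0"
    by (simp only: trace_add trace_scaleR)
  note trace_simps = trace_add trace_sub trace_scaleR
  have Q2: "moment2 F = ?t2 - 2 * m * ?t1 + m\<^sup>2 * ?t0"
    unfolding moment2_def centred_def m_def[symmetric]
    by (simp add: expand trace_simps) (simp add: algebra_simps power2_eq_square)
  have Q3: "moment3 F = ?t3 - 3 * m * ?t2 + 3 * m\<^sup>2 * ?t1 - m ^ 3 * ?t0"
    unfolding moment3_def centred_def m_def[symmetric]
    by (simp add: expand trace_simps) (simp add: algebra_simps power2_eq_square power3_eq_cube)
  \<comment> \<open>Otherwise F would be scalar and D would vanish.\<close>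
  have "centred F \<noteq> 0"
    using D sshp2_D_scalar[of "centre F"] by (metis centred_def eq_iff_diff_eq_0)
  then have "0 < (1 - norm F) * (norm (centred F))\<^sup>2"
    using \<open>norm F < 1\<close> by simp
  then have "moment2 F \<noteq> 0"
    using moment2_ge[OF sym] by linarith
  note * = centred_normal_equations[OF tr this E1 E2 _ Q2 Q3]
  show "?b * ((1 - m) * (1 - m - \<kappa>) - moment2 F / ?t0) = 1" "?a = ?b * (- 2 * m - \<kappa>)"
    by (rule *; simp add: m_def centre_def \<kappa>_def)+
qed

lemma sshp2_parameters_tendsto:
  fixes F :: "nat \<Rightarrow> real^'n^'n"
  assumes lim: "F \<longlonglongrightarrow> 0" and sym: "\<And>k. transpose (F k) = F k"
  shows "(\<lambda>k. sshp2_alpha (F k)) \<longlonglongrightarrow> 0" and "(\<lambda>k. sshp2_beta (F k)) \<longlonglongrightarrow> 1"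
proof -
  define m t0 Q2 \<kappa> u where
    "m k = centre (F k)" "t0 k = trace (mat 1 - F k)" "Q2 k = moment2 (F k)"
    "\<kappa> k = moment3 (F k) / moment2 (F k)"
    "u k = (1 - m k) * (1 - m k - \<kappa> k) - Q2 k / t0 k" for k
  note defs = this
  let ?n = "real CARD('n)"
  have t0: "t0 \<longlonglongrightarrow> ?n"
    unfolding defs by (rule tendsto_eq_intros lim refl | simp add: trace_I)+
  have m: "m \<longlonglongrightarrow> 0"
  proof -
    have "(\<lambda>k. trace ((mat 1 - F k) ** F k)) \<longlonglongrightarrow> trace ((mat 1 - 0) ** (0::real^'n^'n))"
      by (intro tendsto_intros matrix_mult.tendsto lim)
    then have "m \<longlonglongrightarrow> trace ((mat 1 - 0) ** (0::real^'n^'n)) / ?n"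
      unfolding defs centre_def using t0[unfolded defs] by (intro tendsto_divide) auto
    then show ?thesis by (simp add: trace_def)
  qed
  have G: "(\<lambda>k. centred (F k)) \<longlonglongrightarrow> 0"
    using tendsto_diff[OF lim tendsto_scaleR[OF m tendsto_const[of "mat 1"]]]
    by (simp add: centred_def defs)
  have Q2: "Q2 \<longlonglongrightarrow> 0"
  proof -
    have "Q2 \<longlonglongrightarrow> trace ((mat 1 - 0) ** (0 ** (0::real^'n^'n)))"
      unfolding defs moment2_def by (intro tendsto_intros matrix_mult.tendsto lim G)
    then show ?thesis by (simp add: trace_def)
  qed
  have normF: "\<forall>\<^sub>F k in sequentially. norm (F k) < 1"
    using tendstoD[OF lim, of 1] by simp
  have \<kappa>: "\<kappa> \<longlonglongrightarrow> 0"
  proof (rule Lim_null_comparison)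
    show "\<forall>\<^sub>F k in sequentially. norm (\<kappa> k)
        \<le> norm (mat 1 - F k) * norm (centred (F k)) / (1 - norm (F k))"
      using normF by eventually_elim (use abs_moment_ratio_le[OF sym] in \<open>simp add: defs\<close>)
    have "(\<lambda>k. norm (mat 1 - F k) * norm (centred (F k)) / (1 - norm (F k)))
        \<longlonglongrightarrow> norm (mat 1 - 0 :: real^'n^'n) * norm (0::real^'n^'n) / (1 - norm (0::real^'n^'n))"
      by (intro tendsto_intros lim G) simp
    then show "(\<lambda>k. norm (mat 1 - F k) * norm (centred (F k)) / (1 - norm (F k))) \<longlonglongrightarrow> 0"
      by simp
  qed
  have "u \<longlonglongrightarrow> (1 - 0) * (1 - 0 - 0) - 0 / ?n"
    unfolding defs(5) by (intro tendsto_intros m \<kappa> Q2 t0) simp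
  then have v: "(\<lambda>k. 1 / u k) \<longlonglongrightarrow> 1"
    using tendsto_divide[OF tendsto_const[of 1], of u 1] by simp
  have "\<forall>\<^sub>F k in sequentially. t0 k \<noteq> 0"
    using order_tendstoD(1)[OF t0, of 0] by (auto elim: eventually_mono)
  \<comment> \<open>Indices with D = 0 may keep occurring; there the default values 0 and 1 are
    already the limits, so a conditional identity suffices.\<close>
  with normF have eq: "\<forall>\<^sub>F k in sequentially. sshp2_D (F k) \<noteq> 0 \<longrightarrow>
      sshp2_beta (F k) = 1 / u k \<and> sshp2_alpha (F k) = 1 / u k * (- 2 * m k - \<kappa> k)"
  proof eventually_elim
    case (elim k)
    show ?case
    proof
      assume "sshp2_D (F k) \<noteq> 0"
      then have *: "sshp2_beta (F k) * u k = 1" "sshp2_alpha (F k) = sshp2_beta (F k) * (- 2 * m k - \<kappa> k)"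
        using sshp2_parameters_centred[OF _ sym elim(1)] elim(2) unfolding defs by blast+
      then have "u k \<noteq> 0" by auto
      then have "sshp2_beta (F k) = 1 / u k" using *(1) by (simp add: field_simps)
      with *(2) show "sshp2_beta (F k) = 1 / u k \<and> sshp2_alpha (F k) = 1 / u k * (- 2 * m k - \<kappa> k)"
        by simp
    qed
  qed
  show "(\<lambda>k. sshp2_alpha (F k)) \<longlonglongrightarrow> 0"
  proof (rule Lim_null_comparison)
    show "\<forall>\<^sub>F k in sequentially. norm (sshp2_alpha (F k)) \<le> \<bar>1 / u k * (- 2 * m k - \<kappa> k)\<bar>"
      using eq by eventually_elim (auto simp: sshp2_alpha_def)
    have "(\<lambda>k. \<bar>1 / u k * (- 2 * m k - \<kappa> k)\<bar>) \<longlonglongrightarrow> \<bar>1 * (- 2 * 0 - 0)\<bar>"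
      by (intro tendsto_intros v m \<kappa>)
    then show "(\<lambda>k. \<bar>1 / u k * (- 2 * m k - \<kappa> k)\<bar>) \<longlonglongrightarrow> 0" by simp
  qed
  have "(\<lambda>k. sshp2_beta (F k) - 1) \<longlonglongrightarrow> 0"
  proof (rule Lim_null_comparison)
    show "\<forall>\<^sub>F k in sequentially. norm (sshp2_beta (F k) - 1) \<le> \<bar>1 / u k - 1\<bar>"
      using eq by eventually_elim (auto simp: sshp2_beta_def)
    have "(\<lambda>k. \<bar>1 / u k - 1\<bar>) \<longlonglongrightarrow> \<bar>1 - 1\<bar>"
      by (intro tendsto_intros v)
    then show "(\<lambda>k. \<bar>1 / u k - 1\<bar>) \<longlonglongrightarrow> 0" by simp
  qed
  then show "(\<lambda>k. sshp2_beta (F k)) \<longlonglongrightarrow> 1"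
    by (simp only: LIM_zero_iff)
qed

section \<open>Symmetry and boundedness of the residuals\<close>

lemma sshp2_F_0: "sshp2_F A (\<alpha> *\<^sub>R transpose A) 0 = mat 1 - \<alpha> *\<^sub>R (A ** transpose A)"
  by (simp add: sshp2_F_def matrix_mult.scaleR_right)

lemma sshp2_F_Suc_step: "sshp2_F A X0 (Suc k) = sshp2_step (sshp2_F A X0 k)"
  unfolding sshp2_F_Suc sshp2_step_def ..

lemma transpose_sshp2_F:
  "transpose (sshp2_F A (\<alpha> *\<^sub>R transpose A) k) = sshp2_F A (\<alpha> *\<^sub>R transpose A) k"
proof (induction k)
  case 0
  show ?case
    unfolding sshp2_F_0 by (simp add: transpose_diff transpose_scalar matrix_transpose_mul)
next
  case (Suc k)
  then show ?case unfolding sshp2_F_Suc_step by (rule transpose_sshp2_step)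
qed

text \<open>Handles D = 0 at the first step, where F is squared: on a unit vector v, c = 1 -
  \<alpha> ||A^T v||^2, and the step length keeps this at least -1.\<close>

lemma scalar_initial_residual:
  fixes A :: "real^'n^'n"
  assumes "0 < \<alpha>" and \<alpha>: "\<alpha> < 2 / (spectral_norm A)\<^sup>2"
    and c: "mat 1 - \<alpha> *\<^sub>R (A ** transpose A) = c *\<^sub>R mat 1"
  shows "\<bar>c\<bar> \<le> 1"
proof -
  define v :: "real^'n" where "v = axis undefined 1"
  define w where "w = transpose A *v v"
  let ?s = "spectral_norm A"
  have v: "norm v = 1" by (simp add: v_def)
  have "A ** transpose A *v v = A *v w"
    unfolding w_def matrix_vector_mul_assoc ..
  have "(mat 1 - \<alpha> *\<^sub>R (A ** transpose A)) *v v = (c *\<^sub>R mat 1) *v v"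
    unfolding c ..
  then have eq: "v - \<alpha> *\<^sub>R (A *v w) = c *\<^sub>R v"
    by (simp only: matrix_vector_mult.diff_left matrix_vector_mult.scaleR_left
        \<open>A ** transpose A *v v = A *v w\<close> matrix_vector_mul_lid)
  have "(A *v w) \<bullet> v = w \<bullet> w"
    by (metis dot_lmul_matrix inner_commute transpose_matrix_vector w_def)
  moreover have "(v - \<alpha> *\<^sub>R (A *v w)) \<bullet> v = c * (v \<bullet> v)"
    unfolding eq by simp
  ultimately have cw: "1 - \<alpha> * (norm w)\<^sup>2 = c"
    using v by (simp add: inner_diff_left norm_eq_1 power2_norm_eq_inner)
  have Aw: "norm (A *v w) \<le> ?s * norm w"
    unfolding spectral_norm_def by (intro onorm) simp
  \<comment> \<open>As <A w, v> = ||w||^2 for w = A^T v, the operator bound for A also bounds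
    w.\<close>
  have "norm w * norm w \<le> norm (A *v w)"
    using \<open>(A *v w) \<bullet> v = w \<bullet> w\<close> norm_cauchy_schwarz[of "A *v w" v] v
    by (simp add: power2_norm_eq_inner[symmetric] power2_eq_square)
  with Aw have "norm w * norm w \<le> ?s * norm w" by linarith
  moreover have "?s \<ge> 0" unfolding spectral_norm_def by (intro onorm_pos_le) simp
  ultimately have "norm w \<le> ?s"
    by (cases "w = 0") auto
  then have "\<alpha> * (norm w)\<^sup>2 \<le> \<alpha> * ?s\<^sup>2"
    using \<open>0 < \<alpha>\<close> by (simp add: power_mono)
  also have "\<dots> \<le> 2"
  proof -
    \<comment> \<open>With a zero norm, 2 / 0 = 0 would turn the bound into \<alpha> < 0.\<close>
    have "?s \<noteq> 0" using assms(1,2) by auto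
    then show ?thesis using \<alpha> by (simp add: field_simps)
  qed
  finally have "c \<ge> -1" using cw by linarith
  moreover have "c \<le> 1" using cw \<open>0 < \<alpha>\<close> by (simp flip: cw)
  ultimately show ?thesis by simp
qed

lemma norm_sshp2_step_le:
  fixes F :: "real^'n^'n"
  assumes sym: "transpose F = F" and spec: "1 \<notin> matrix_spectrum F"
    and scalar: "\<And>c. F = c *\<^sub>R mat 1 \<Longrightarrow> \<bar>c\<bar> \<le> 1"
  shows "norm (sshp2_step F) \<le> norm (mat 1 :: real^'n^'n)"
proof (cases "sshp2_D F = 0")
  case True
  then obtain c where c: "F = c *\<^sub>R mat 1"
    using sshp2_D_eq_0_imp_scalar sym spec by blast
  have "sshp2_step F = F ** F"
    using True by (simp add: sshp2_step_def sshp2_alpha_def sshp2_beta_def)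
  also have "\<dots> = c\<^sup>2 *\<^sub>R mat 1"
    by (simp add: c matrix_mult.scaleR_left matrix_mult.scaleR_right power2_eq_square)
  finally have "norm (sshp2_step F) = c\<^sup>2 * norm (mat 1 :: real^'n^'n)" by simp
  moreover have "c\<^sup>2 \<le> 1" using scalar[OF c] by (simp add: abs_square_le_1)
  ultimately show ?thesis by (simp add: mult_left_le_one_le)
next
  case False
  then show ?thesis using norm_sshp2_step_le_of_D sym by blast
qed

text \<open>The condition on scalar residuals comes from the step length at index 0 and afterwards
  from the inductive bound itself: |c| ||I|| \<le> ||I||.\<close>

lemma norm_sshp2_F_Suc_le:
  fixes A :: "real^'n^'n"
  assumes "0 < \<alpha>" and "\<alpha> < 2 / (spectral_norm A)\<^sup>2"
    and spec: "\<And>k. 1 \<notin> matrix_spectrum (sshp2_F A (\<alpha> *\<^sub>R transpose A) k)"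
  shows "norm (sshp2_F A (\<alpha> *\<^sub>R transpose A) (Suc k)) \<le> norm (mat 1 :: real^'n^'n)"
proof (induction k)
  case 0
  show ?case
    unfolding sshp2_F_Suc_step
    by (rule norm_sshp2_step_le[OF transpose_sshp2_F spec])
      (use scalar_initial_residual[OF assms(1,2)] in \<open>simp add: sshp2_F_0\<close>)
next
  case (Suc k)
  have "\<bar>c\<bar> \<le> 1" if "sshp2_F A (\<alpha> *\<^sub>R transpose A) (Suc k) = c *\<^sub>R mat 1" for c
  proof -
    have "norm (mat 1 :: real^'n^'n) > 0"
      by (simp add: vec_eq_iff mat_def)
    then show ?thesis using Suc unfolding that by simp
  qed
  then show ?case
    by (subst sshp2_F_Suc_step) (rule norm_sshp2_step_le[OF transpose_sshp2_F spec])
qed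

section \<open>The two directions of the equivalence\<close>

text \<open>The coefficients of each step sum to 1, so a vector fixed by one residual is fixed by
  all later ones.\<close>

lemma not_sshp2_converges_if_eigenvalue_1:
  assumes "1 \<in> matrix_spectrum (sshp2_F A X0 k)"
  shows "\<not> sshp2_converges A X0"
proof
  assume conv: "sshp2_converges A X0"
  obtain v where v: "v \<noteq> 0" "sshp2_F A X0 k *v v = v"
    using assms by (auto simp: matrix_spectrum_def)
  have eigen: "sshp2_F A X0 j *v v = v" if "j \<ge> k" for j
    using that
  proof (induction j rule: dec_induct)
    case (step j)
    then show ?case
      unfolding sshp2_F_Suc_step using sshp2_step_eigenvector[of _ v 1] by simp
  qed (rule v)
  have "(\<lambda>j. sshp2_F A X0 j *v v) \<longlonglongrightarrow> 0 *v v"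
    using conv unfolding sshp2_converges_def by (intro matrix_vector_mult.tendsto tendsto_const)
  moreover have "(\<lambda>j. sshp2_F A X0 j *v v) \<longlonglongrightarrow> v"
    by (rule tendsto_eventually) (use eigen in \<open>auto simp: eventually_sequentially\<close>)
  ultimately show False
    using LIMSEQ_unique v(1) by fastforce
qed

text \<open>Along v the method is the scalar recursion; the norm bound supplies boundedness and the
  spectral condition excludes the value 1.\<close>

lemma sshp2_eigenvector_tendsto_0:
  fixes A X0 :: "real^'n^'n"
  assumes v: "sshp2_F A X0 0 *v v = c *\<^sub>R v" and bdd: "\<And>k. norm (sshp2_F A X0 k) \<le> C"
    and spec: "\<And>k. 1 \<notin> matrix_spectrum (sshp2_F A X0 k)"
    and lim: "(\<lambda>k. sshp2_alpha (sshp2_F A X0 k)) \<longlonglongrightarrow> 0" "(\<lambda>k. sshp2_beta (sshp2_F A X0 k)) \<longlonglongrightarrow> 1"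
  shows "(\<lambda>k. sshp2_F A X0 k *v v) \<longlonglongrightarrow> 0"
proof (cases "v = 0")
  case False
  let ?F = "sshp2_F A X0"
  have "\<exists>d. ?F k *v v = d *\<^sub>R v" for k
  proof (induction k)
    case (Suc k)
    then show ?case unfolding sshp2_F_Suc_step by (meson sshp2_step_eigenvector)
  qed (use v in blast)
  then obtain x where x: "\<And>k. ?F k *v v = x k *\<^sub>R v" by metis
  have "x \<longlonglongrightarrow> 0"
  proof (rule scalar_recurrence_tendsto_0[OF _ _ _ lim])
    fix k
    let ?a = "sshp2_alpha (?F k)" and ?b = "sshp2_beta (?F k)"
    have "x (Suc k) *\<^sub>R v = (1 - ?a - ?b + ?a * x k + ?b * (x k)\<^sup>2) *\<^sub>R v"
      using sshp2_step_eigenvector[OF x[of k]] x[of "Suc k"] by (simp only: sshp2_F_Suc_step)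
    then show "x (Suc k) = 1 - ?a - ?b + ?a * x k + ?b * (x k)\<^sup>2"
      using False by (simp only: scaleR_cancel_right) simp
    have "\<bar>x k\<bar> * norm v \<le> norm (?F k) * norm v"
      using norm_matrix_vector_mult_le[of "?F k" v] by (simp add: x)
    then show "\<bar>x k\<bar> \<le> C"
      using False bdd[of k] by simp
    show "x k \<noteq> 1"
      using spec[of k] False x[of k] by (auto simp: matrix_spectrum_def)
  qed
  then have "(\<lambda>k. x k *\<^sub>R v) \<longlonglongrightarrow> 0 *\<^sub>R v"
    by (intro tendsto_intros)
  then show ?thesis by (simp add: x)
qed simp

theorem theorem3p8:
  fixes A X0 :: "real^'n^'n" and \<alpha> :: real
  assumes "invertible A"
    and "0 < \<alpha>" and "\<alpha> < 2 / (spectral_norm A)\<^sup>2"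
    and "X0 = \<alpha> *\<^sub>R transpose A"
  shows "sshp2_converges A X0 \<longleftrightarrow>
           (\<forall>k. 1 \<notin> matrix_spectrum (sshp2_F A X0 k)) \<and>
           (\<lambda>k. sshp2_alpha (sshp2_F A X0 k)) \<longlonglongrightarrow> 0 \<and>
           (\<lambda>k. sshp2_beta (sshp2_F A X0 k)) \<longlonglongrightarrow> 1"
  (is "_ \<longleftrightarrow> ?spec \<and> ?a \<and> ?b")
proof
  let ?F = "sshp2_F A X0"
  have sym: "transpose (?F k) = ?F k" for k
    unfolding assms(4) by (rule transpose_sshp2_F)
  {
    assume conv: "sshp2_converges A X0"
    then have "?F \<longlonglongrightarrow> 0" by (simp add: sshp2_converges_def)
    then have ?a ?b by (rule sshp2_parameters_tendsto[OF _ sym])+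
    with conv show "?spec \<and> ?a \<and> ?b" using not_sshp2_converges_if_eigenvalue_1 by blast
  next
    assume *: "?spec \<and> ?a \<and> ?b"
    have "norm (?F k) \<le> max (norm (?F 0)) (norm (mat 1 :: real^'n^'n))" for k
      using norm_sshp2_F_Suc_le[OF assms(2,3)] * unfolding assms(4)
      by (cases k) (auto simp: le_max_iff_disj)
    then have ev: "(\<lambda>k. ?F k *v v) \<longlonglongrightarrow> 0" if "v \<in> {v. \<exists>c. ?F 0 *v v = c *\<^sub>R v}" for v
      using that * sshp2_eigenvector_tendsto_0[of A X0 v] by blast
    have "?F \<longlonglongrightarrow> 0"
      by (rule tendsto_matrix_0I[OF ev symmetric_matrix_span_eigenvectors[OF sym]])
    then show "sshp2_converges A X0" by (simp add: sshp2_converges_def)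
  }
qed

end
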